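(* Let $n\geq 4$, let $P_n(t)=\sum_{i=0}^{n-3}\dim H^{2i}(\overline{\mathcal M}_{0,n};\mathbb Q)\,t^i$, and let $$\tau_1<\tau_2<\cdots<\tau_{n-3}<0$$ be the roots of $P_n(t)$. If $$\sigma_1<\sigma_2<\cdots<\sigma_{n-2}<0$$ are the roots of $P_{n+1}(t)$, then $$\sigma_1<\tau_1<\sigma_2<\tau_2<\cdots<\sigma_{n-3}<\tau_{n-3}<\sigma_{n-2}<0.$$
   Context: $\overline{\mathcal M}_{0,n}$ ($n\ge 3$) is the Deligne--Mumford moduli space of stable $n$-pointed rational curves (over $\mathbb C$), a smooth irreducible projective variety of dimension $n-3$ with vanishing odd cohomology. $P_n(t)$ is monic of degree $n-3$ with $P_n(0)=1$. With the convention $P_1(t)=P_2(t)=P_3(t)=1$, the polynomials $P_n(t)$ are computed by the standard (Keel--Manin--Getzler) recurrence, valid for $n>3$: $$P_n(t)=(1+t)P_{n-1}(t)+t\sum_{j=3}^{n-2}\binom{n-2}{j-1}P_j(t)P_{n+1-j}(t),$$ where an empty sum is zero. For every $n\ge 4$, $P_n(t)$ has exactly $n-3$ roots, all simple, real and negative, so that the ordered lists of roots in the claim make sense. *)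

theory Defs
  imports
    "HOL-Analysis.Analysis"
    "HOL-Homology.Simplices"
    "HOL-Computational_Algebra.Polynomial"
begin

section \<open>The projective line over the complex numbers\<close>

text \<open>Points of the projective line are of type \<^typ>\<open>complex option\<close>, with \<^term>\<open>None\<close>
  as the point at infinity.\<close>

definition riemann_sphere :: "complex option topology" where
  "riemann_sphere = Alexandroff_compactification (euclidean :: complex topology)"

definition sphere_moebius ::
    "complex \<Rightarrow> complex \<Rightarrow> complex \<Rightarrow> complex \<Rightarrow> complex option \<Rightarrow> complex option" where
  "sphere_moebius a b c d p =
     (case p of
        None \<Rightarrow> if c = 0 then None else Some (a / c)
      | Some z \<Rightarrow> if c * z + d = 0 then None else Some (moebius a b c d z))"

definition sphere_automorphisms :: "(complex option \<Rightarrow> complex option) set" where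
  "sphere_automorphisms = {sphere_moebius a b c d | a b c d. a * d - b * c \<noteq> 0}"

text \<open>\<open>sphere_minor p q\<close> is the determinant of the homogeneous coordinates \<open>(z, 1)\<close> of
  \<open>Some z\<close> and \<open>(1, 0)\<close> of \<open>None\<close>; so it is \<open>p - q\<close> for finite points, and the
  cross ratio below is \<open>(p - r)(q - s) / ((p - s)(q - r))\<close>. Numerator and
  denominator do not vanish together when at least three of the four points are distinct.\<close>

fun sphere_minor :: "complex option \<Rightarrow> complex option \<Rightarrow> complex" where
  "sphere_minor (Some z) (Some w) = z - w"
| "sphere_minor None (Some w) = 1"
| "sphere_minor (Some z) None = - 1"
| "sphere_minor None None = 0"

definition cross_ratio ::
    "complex option \<Rightarrow> complex option \<Rightarrow> complex option \<Rightarrow> complex option \<Rightarrow> complex option" where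
  "cross_ratio p q r s =
     (let num = sphere_minor p r * sphere_minor q s;
          den = sphere_minor p s * sphere_minor q r
      in if den = 0 then None else Some (num / den))"


section \<open>Stable pointed rational curves\<close>

text \<open>A nodal rational curve is a tree of projective lines: its irreducible components are the
  vertices of a finite tree, \<open>node C a b\<close> is the point of the component \<open>a\<close> at which the adjacent
  component \<open>b\<close> is attached (glued to the point \<open>node C b a\<close> of \<open>b\<close>), and the marked point
  with label \<open>i\<close> is the point \<open>mark C i\<close> of the component \<open>mark_comp C i\<close>. The values of these
  functions at other arguments are irrelevant. Vertices are natural numbers, which is
  no restriction since the tree is finite.\<close>

record pointed_curve =
  comps :: "nat set"
  adj :: "nat \<Rightarrow> nat \<Rightarrow> bool"
  node :: "nat \<Rightarrow> nat \<Rightarrow> complex option"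
  mark_comp :: "nat \<Rightarrow> nat"
  mark :: "nat \<Rightarrow> complex option"

definition dual_graph_is_tree :: "pointed_curve \<Rightarrow> bool" where
  "dual_graph_is_tree C \<longleftrightarrow>
     finite (comps C) \<and> comps C \<noteq> {} \<and>
     (\<forall>a b. adj C a b \<longrightarrow> a \<in> comps C \<and> b \<in> comps C \<and> a \<noteq> b \<and> adj C b a) \<and>
     (\<forall>a\<in>comps C. \<forall>b\<in>comps C. (adj C)\<^sup>*\<^sup>* a b) \<and>
     card {{a, b} | a b. adj C a b} + 1 = card (comps C)"

text \<open>The special points of a component are its nodes and its marked points. They have to be
  pairwise distinct, and stability means that there are at least three on every component.\<close>

definition stable_curve :: "nat \<Rightarrow> pointed_curve \<Rightarrow> bool" where
  "stable_curve n C \<longleftrightarrow>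
     dual_graph_is_tree C \<and>
     (\<forall>i\<in>{1..n}. mark_comp C i \<in> comps C) \<and>
     (\<forall>a\<in>comps C.
        inj_on (node C a) {b. adj C a b} \<and>
        inj_on (mark C) {i\<in>{1..n}. mark_comp C i = a} \<and>
        node C a ` {b. adj C a b} \<inter> mark C ` {i\<in>{1..n}. mark_comp C i = a} = {} \<and>
        card {b. adj C a b} + card {i\<in>{1..n}. mark_comp C i = a} \<ge> 3)"

definition curve_iso :: "nat \<Rightarrow> pointed_curve \<Rightarrow> pointed_curve \<Rightarrow> bool" where
  "curve_iso n C D \<longleftrightarrow>
     (\<exists>\<phi> m. bij_betw \<phi> (comps C) (comps D) \<and>
        (\<forall>a\<in>comps C. m a \<in> sphere_automorphisms) \<and>
        (\<forall>a\<in>comps C. \<forall>b\<in>comps C. adj D (\<phi> a) (\<phi> b) \<longleftrightarrow> adj C a b) \<and>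
        (\<forall>a b. adj C a b \<longrightarrow> node D (\<phi> a) (\<phi> b) = m a (node C a b)) \<and>
        (\<forall>i\<in>{1..n}. mark_comp D i = \<phi> (mark_comp C i) \<and>
                    mark D i = m (mark_comp C i) (mark C i)))"

definition moduli_points :: "nat \<Rightarrow> pointed_curve set set" where
  "moduli_points n =
     {C. stable_curve n C} //
     {(C, D). stable_curve n C \<and> stable_curve n D \<and> curve_iso n C D}"


section \<open>The moduli space as a topological space\<close>

text \<open>\<open>branch_towards C a v\<close> is the neighbour of \<open>a\<close> on the path from \<open>a\<close> to \<open>v\<close>, for \<open>v \<noteq> a\<close>.
  \<open>projected_mark C a i\<close> is the image of the \<open>i\<close>-th marked point under the contraction of the
  curve onto its component \<open>a\<close>.\<close>

definition branch_towards :: "pointed_curve \<Rightarrow> nat \<Rightarrow> nat \<Rightarrow> nat" where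
  "branch_towards C a v =
     (THE b. adj C a b \<and> (\<lambda>x y. adj C x y \<and> x \<noteq> a \<and> y \<noteq> a)\<^sup>*\<^sup>* b v)"

definition projected_mark :: "pointed_curve \<Rightarrow> nat \<Rightarrow> nat \<Rightarrow> complex option" where
  "projected_mark C a i =
     (if mark_comp C i = a then mark C i else node C a (branch_towards C a (mark_comp C i)))"

text \<open>The cross ratio of four marked points extends from smooth to stable curves: it is taken on
  any component on which the four marked points have at least three distinct projections. Such a
  component exists, and all of them give the same value.\<close>

definition curve_cross_ratio ::
    "pointed_curve \<Rightarrow> nat \<times> nat \<times> nat \<times> nat \<Rightarrow> complex option" where
  "curve_cross_ratio C = (\<lambda>(i, j, k, l). THE w. \<exists>a\<in>comps C.
     card (projected_mark C a ` {i, j, k, l}) \<ge> 3 \<and>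
     w = cross_ratio (projected_mark C a i) (projected_mark C a j)
                     (projected_mark C a k) (projected_mark C a l))"

definition label_quadruples :: "nat \<Rightarrow> (nat \<times> nat \<times> nat \<times> nat) set" where
  "label_quadruples n = {(i, j, k, l). {i, j, k, l} \<subseteq> {1..n} \<and> distinct [i, j, k, l]}"

definition moduli_cross_ratios ::
    "nat \<Rightarrow> pointed_curve set \<Rightarrow> nat \<times> nat \<times> nat \<times> nat \<Rightarrow> complex option" where
  "moduli_cross_ratios n X =
     (\<lambda>q\<in>label_quadruples n. the_elem ((\<lambda>C. curve_cross_ratio C q) ` X))"

text \<open>The analytic (classical) topology of the moduli space of stable \<open>n\<close>-pointed
  rational curves: the cross ratios embed the moduli space as a closed subvariety of a product
  of projective lines (Gerritzen, Herrlich and van der Put; see also McDuff and Salamon,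
  J-holomorphic Curves and Symplectic Topology, Appendix D), so its topology is the
  coarsest one for which all of them are continuous.\<close>

definition Mbar0 :: "nat \<Rightarrow> pointed_curve set topology" where
  "Mbar0 n =
     pullback_topology (moduli_points n) (moduli_cross_ratios n)
       (product_topology (\<lambda>_. riemann_sphere) (label_quadruples n))"


section \<open>Rational singular cohomology and the Poincare polynomial\<close>

definition cochains :: "nat \<Rightarrow> 'a topology \<Rightarrow> (((nat \<Rightarrow> real) \<Rightarrow> 'a) \<Rightarrow> rat) set" where
  "cochains p X = {f. \<forall>s. \<not> singular_simplex p X s \<longrightarrow> f s = 0}"

definition coboundary ::
    "nat \<Rightarrow> 'a topology \<Rightarrow> (((nat \<Rightarrow> real) \<Rightarrow> 'a) \<Rightarrow> rat) \<Rightarrow> (((nat \<Rightarrow> real) \<Rightarrow> 'a) \<Rightarrow> rat)" where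
  "coboundary p X f =
     (\<lambda>s. if singular_simplex (Suc p) X s
          then \<Sum>k\<le>Suc p. (- 1) ^ k * f (singular_face (Suc p) k s) else 0)"

definition cocycles :: "nat \<Rightarrow> 'a topology \<Rightarrow> (((nat \<Rightarrow> real) \<Rightarrow> 'a) \<Rightarrow> rat) set" where
  "cocycles p X = {f \<in> cochains p X. coboundary p X f = (\<lambda>_. 0)}"

definition coboundaries :: "nat \<Rightarrow> 'a topology \<Rightarrow> (((nat \<Rightarrow> real) \<Rightarrow> 'a) \<Rightarrow> rat) set" where
  "coboundaries p X =
     (case p of 0 \<Rightarrow> {\<lambda>_. 0} | Suc q \<Rightarrow> coboundary q X ` cochains q X)"

text \<open>The dimension over the rationals of the quotient of cocycles by coboundaries, as the largest
  number of cocycles whose classes are linearly independent. (It is meaningful only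
  for finite-dimensional cohomology.)\<close>

definition dim_cohomology :: "nat \<Rightarrow> 'a topology \<Rightarrow> nat" where
  "dim_cohomology p X =
     (GREATEST d. \<exists>S. S \<subseteq> cocycles p X \<and> finite S \<and> card S = d \<and>
        (\<forall>c. (\<lambda>s. \<Sum>f\<in>S. c f * f s) \<in> coboundaries p X \<longrightarrow> (\<forall>f\<in>S. c f = 0)))"

text \<open>For \<open>n \<le> 3\<close> the value 1 is a convention; for \<open>n = 3\<close> it agrees with the general formula, the
  moduli space being a point.\<close>

definition poincare_poly :: "nat \<Rightarrow> real poly" where
  "poincare_poly n = (if n \<le> 3 then 1
          else \<Sum>i=0..n - 3. Polynomial.monom (of_nat (dim_cohomology (2 * i) (Mbar0 n))) i)"

end

theory Submission
  imports Defs "HOL-Computational_Algebra.Computational_Algebra"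
begin

text \<open>
  Let \<open>\<phi> = (\<Sum>n\<ge>1. P\<^bsub>n+1\<^esub>(t) x\<^sup>n / n!)\<close>, \<open>u = 1 + \<phi>\<close> and \<open>y = \<phi>'\<close>. The recurrence says
  \<open>(1 + t x - t \<phi>) \<phi>' = 1 + \<phi>\<close>, and differentiating this gives \<open>u y' = y\<^sup>2 (1 + c)\<close> with
  \<open>c = t (y - 1)\<close>. Hence all derivatives of \<open>\<phi>\<close> are, up to powers of \<open>u\<close> and \<open>y\<close>, polynomials
  \<open>(1 + c) R\<^sub>k(c)\<close> in \<open>c\<close>, where
  \<open>R\<^bsub>k+1\<^esub> = ((k + 3) c + 1 + t) R\<^sub>k + (c + 1) (c + t) R\<^sub>k'\<close> is linear, and \<open>P\<^bsub>k+3\<^esub>(t) = R\<^sub>k(0)\<close>.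
  For fixed \<open>t < 0\<close> a sign-change argument shows that the \<open>R\<^sub>k\<close> have \<open>k\<close> simple roots in
  \<open>(-1, -t)\<close> and interlace; as \<open>R\<^bsub>k+1\<^esub>(0) = t R\<^sub>k'(0)\<close> at a zero of \<open>R\<^sub>k(0)\<close>, the values
  \<open>P\<^bsub>m-1\<^esub>(t)\<close> and \<open>P\<^bsub>m+1\<^esub>(t)\<close> have opposite signs whenever \<open>P\<^sub>m(t) = 0\<close>. So the \<open>P\<^sub>m\<close>
  form a Sturm sequence on the negative half-line, and the same sign-change argument, now in \<open>t\<close>,
  gives the interlacing.
\<close>

section \<open>Interlacing\<close>

lemma sign_prod_split:
  fixes g :: "nat \<Rightarrow> real"
  assumes "k \<le> d" "\<And>i. i < k \<Longrightarrow> g i > 0" "\<And>i. k \<le> i \<Longrightarrow> i < d \<Longrightarrow> g i < 0"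
  shows "(-1) ^ (d - k) * (\<Prod>i<d. g i) > 0"
  using assms
proof (induction d)
  case (Suc d)
  show ?case
  proof (cases "k = Suc d")
    case True
    then have "(\<Prod>i<Suc d. g i) > 0" using Suc.prems by (intro prod_pos) auto
    with True show ?thesis by simp
  next
    case False
    then have k: "k \<le> d" using Suc.prems by simp
    then have "(-1) ^ (d - k) * (\<Prod>i<d. g i) > 0" "- g d > 0" using Suc by auto
    then have "((-1) ^ (d - k) * (\<Prod>i<d. g i)) * (- g d) > 0" by (rule mult_pos_pos)
    with k show ?thesis by (simp add: Suc_diff_le algebra_simps)
  qed
qed auto

text \<open>Listing the roots in increasing order and keeping the constant \<open>l\<close> positive
  makes every sign a matter of counting: between roots, \<open>p\<close> has sign (-1) to the number
  of roots further right. Strict monotonicity encodes simplicity.\<close>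

definition real_factored :: "real poly \<Rightarrow> nat \<Rightarrow> (nat \<Rightarrow> real) \<Rightarrow> bool" where
  "real_factored p d r \<longleftrightarrow> strict_mono_on {..<d} r \<and>
     (\<exists>l>0. p = smult l (\<Prod>i<d. [:- r i, 1:]))"

lemma real_factored_sign:
  assumes "real_factored p d r" "k \<le> d"
    and "\<And>i. i < k \<Longrightarrow> r i < x" "\<And>i. k \<le> i \<Longrightarrow> i < d \<Longrightarrow> x < r i"
  shows "(-1) ^ (d - k) * poly p x > 0"
proof -
  obtain l where l: "l > 0" "p = smult l (\<Prod>i<d. [:- r i, 1:])"
    using assms(1) by (auto simp: real_factored_def)
  have "(-1) ^ (d - k) * (\<Prod>i<d. x - r i) > 0"
    using assms by (intro sign_prod_split) auto
  then have "l * ((-1) ^ (d - k) * (\<Prod>i<d. x - r i)) > 0"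
    using l(1) by (rule mult_pos_pos[rotated])
  then show ?thesis
    by (simp add: l(2) poly_prod algebra_simps)
qed

text \<open>At a simple root the derivative is the product of the remaining factors, of which the
  \<open>d - Suc k\<close> belonging to larger roots are negative.\<close>

lemma real_factored_pderiv_sign:
  assumes "real_factored p d r" "k < d"
  shows "(-1) ^ (d - Suc k) * poly (pderiv p) (r k) > 0"
proof -
  obtain l where l: "l > 0" "p = smult l (\<Prod>i<d. [:- r i, 1:])"
    using assms(1) by (auto simp: real_factored_def)
  define h where "h = smult l (\<Prod>i\<in>{..<d} - {k}. [:- r i, 1:])"
  have "p = [:- r k, 1:] * h"
    using assms(2) prod.remove[of "{..<d}" k "\<lambda>i. [:- r i, 1:]"]
    by (simp only: l(2) h_def mult_smult_right finite_lessThan lessThan_iff)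
  then have "poly (pderiv p) (r k) = poly h (r k)"
    by (simp only: pderiv_mult) (simp add: pderiv_pCons)
  also have "\<dots> = l * (\<Prod>i\<in>{..<d} - {k}. r k - r i)"
    by (simp add: h_def poly_prod)
  \<comment> \<open>Putting 1 in the place of the missing factor keeps the index set an initial
    segment and counts it as positive, so the sign change occurs at \<open>Suc k\<close>.\<close>
  also have "(\<Prod>i\<in>{..<d} - {k}. r k - r i) = (\<Prod>i<d. if i = k then 1 else r k - r i)"
    using assms(2) by (subst prod.remove[of "{..<d}" k]) (auto intro!: prod.cong)
  finally have *: "poly (pderiv p) (r k) = l * (\<Prod>i<d. if i = k then 1 else r k - r i)" .
  have "strict_mono_on {..<d} r" using assms(1) by (simp add: real_factored_def)
  then have "(-1) ^ (d - Suc k) * (\<Prod>i<d. if i = k then 1 else r k - r i) > 0"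
    using assms(2) by (intro sign_prod_split) (auto simp: strict_mono_on_def)
  then have "l * ((-1) ^ (d - Suc k) * (\<Prod>i<d. if i = k then 1 else r k - r i)) > 0"
    using l(1) by (rule mult_pos_pos[rotated])
  then show ?thesis
    by (simp add: * algebra_simps)
qed

lemma prod_linear_dvd:
  fixes p :: "'a :: field poly" and r :: "nat \<Rightarrow> 'a"
  assumes "inj_on r {..<d}" "\<And>i. i < d \<Longrightarrow> poly p (r i) = 0"
  shows "(\<Prod>i<d. [:- r i, 1:]) dvd p"
  using assms
proof (induction d)
  case (Suc d)
  have "(\<Prod>i<d. [:- r i, 1:]) dvd p"
    using Suc.prems by (intro Suc.IH) (auto simp: inj_on_def)
  then obtain q where q: "p = (\<Prod>i<d. [:- r i, 1:]) * q" by (elim dvdE)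
  have "poly (\<Prod>i<d. [:- r i, 1:]) (r d) \<noteq> 0"
    using inj_onD[OF Suc.prems(1), of d] by (fastforce simp: poly_prod)
  moreover have "poly p (r d) = 0" using Suc.prems by simp
  ultimately have "poly q (r d) = 0" by (simp add: q)
  then have "[:- r d, 1:] dvd q" by (simp add: poly_eq_0_iff_dvd)
  then show ?case unfolding q by (simp only: prod.lessThan_Suc mult_dvd_mono dvd_refl)
qed auto

text \<open>As many distinct roots as the degree leave only a constant cofactor, which is the
  leading coefficient.\<close>

lemma real_factoredI:
  assumes "strict_mono_on {..<d} r" "\<And>i. i < d \<Longrightarrow> poly p (r i) = 0"
    and "degree p = d" "lead_coeff p > 0"
  shows "real_factored p d r"
proof -
  let ?m = "\<Prod>i<d. [:- r i, 1:]"
  have "?m dvd p"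
    using assms by (intro prod_linear_dvd strict_mono_on_imp_inj_on) auto
  then obtain q where q: "p = ?m * q" by (elim dvdE)
  have "p \<noteq> 0" using assms by auto
  have m: "degree ?m = d" "lead_coeff ?m = 1"
    by (simp add: degree_prod_eq_sum_degree, subst lead_coeff_prod, simp)
  have "degree p = degree ?m + degree q"
    using \<open>p \<noteq> 0\<close> q by (metis degree_mult_eq mult_eq_0_iff)
  then have "degree q = 0" using assms(3) m(1) by simp
  then obtain c where c: "q = [:c:]" by (metis degree_eq_zeroE)
  have "lead_coeff q = c" by (simp add: c)
  then have "lead_coeff (?m * q) = c" by (simp only: lead_coeff_mult m(2) mult_1_left)
  then have "c > 0" using assms(4) unfolding q by (simp only:)
  then show ?thesis
    using assms(1) q c unfolding real_factored_def by (intro conjI exI[of _ c]) auto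
qed

lemma real_factored_roots:
  assumes "real_factored p d r"
  shows "{x. poly p x = 0} = r ` {..<d}"
proof -
  obtain l where "l > 0" "p = smult l (\<Prod>i<d. [:- r i, 1:])"
    using assms(1) by (auto simp: real_factored_def)
  then show ?thesis by (auto simp: poly_prod)
qed

text \<open>The sign of \<open>p'\<close> alternates along the roots of \<open>p\<close>, hence so
  does that of \<open>f\<close>; with the signs at \<open>a\<close> and \<open>b\<close> there are
  \<open>Suc d\<close> sign changes, as many as \<open>f\<close> can have roots. The last conclusion
  prepares the next application, in which \<open>f\<close> takes the place of
  \<open>p\<close>.\<close>

lemma interlacing_roots:
  fixes f p :: "real poly"
  assumes p: "real_factored p d r" and "a < b" and r: "\<And>i. i < d \<Longrightarrow> a < r i \<and> r i < b"
    and f: "degree f = Suc d" "lead_coeff f > 0"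
    and ends: "poly f b > 0" "(-1) ^ Suc d * poly f a > 0"
    and opp: "\<And>i. i < d \<Longrightarrow> poly f (r i) * poly (pderiv p) (r i) < 0"
  obtains s where "real_factored f (Suc d) s" "\<And>i. i \<le> d \<Longrightarrow> a < s i \<and> s i < b"
    "\<And>i. i < d \<Longrightarrow> s i < r i \<and> r i < s (Suc i)"
    "\<And>i. i \<le> d \<Longrightarrow> poly p (s i) * poly (pderiv f) (s i) > 0"
proof -
  have mono: "r i < r j" if "i < j" "j < d" for i j
    using p that by (auto simp: real_factored_def strict_mono_on_def)
  \<comment> \<open>The grid \<open>a\<close>, \<open>r 0\<close>, ..., \<open>r (d - 1)\<close>,
    \<open>b\<close>; the roots are shifted by one, so \<open>r j\<close> is
    \<open>e (Suc j)\<close>.\<close>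
  define e where "e i = (if i = 0 then a else if i \<le> d then r (i - 1) else b)" for i
  have e_less: "e i < e (Suc i)" if "i \<le> d" for i
    using that \<open>a < b\<close> r mono[of "i - 1" i] by (auto simp: e_def)
  have e_sign: "(-1) ^ (Suc d - i) * poly f (e i) > 0" if "i \<le> Suc d" for i
  proof -
    consider "i = 0" | "i = Suc d" | j where "i = Suc j" "j < d"
      using \<open>i \<le> Suc d\<close> by (cases i) (auto simp: le_less)
    then show ?thesis
    proof cases
      case (3 j)
      have "((-1) ^ (d - Suc j) * poly (pderiv p) (r j)) > 0"
        using real_factored_pderiv_sign[OF p 3(2)] .
      then have "(-1) ^ (d - j) * poly f (r j) > 0"
        using opp[OF 3(2)] 3(2)
        by (cases "even (d - j)") (auto simp: zero_less_mult_iff mult_less_0_iff even_diff_nat)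
      with 3 show ?thesis by (simp add: e_def)
    qed (use ends in \<open>auto simp: e_def\<close>)
  qed
  have "\<exists>x. e i < x \<and> x < e (Suc i) \<and> poly f x = 0" if "i \<le> d" for i
  proof -
    have "(-1) ^ (Suc d - i) * poly f (e i) > 0" "(-1) ^ (d - i) * poly f (e (Suc i)) > 0"
      using e_sign[of i] e_sign[of "Suc i"] that by auto
    then have "poly f (e i) * poly f (e (Suc i)) < 0"
      using that by (cases "even (d - i)") (auto simp: Suc_diff_le mult_less_0_iff zero_less_mult_iff)
    with e_less[OF that] show ?thesis using poly_IVT by blast
  qed
  then obtain s where s: "\<And>i. i \<le> d \<Longrightarrow> e i < s i \<and> s i < e (Suc i) \<and> poly f (s i) = 0"
    by metis
  have e_mono: "e i \<le> e j" if "i \<le> j" "j \<le> Suc d" for i j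
    using that
  proof (induction j rule: dec_induct)
    case (step j)
    then show ?case using e_less[of j] by simp
  qed auto
  have sr: "s i < r i \<and> r i < s (Suc i)" if "i < d" for i
    using s[of i] s[of "Suc i"] that by (auto simp: e_def)
  have ab: "a < s i \<and> s i < b" if "i \<le> d" for i
    using s[OF that] e_mono[of 0 i] e_mono[of "Suc i" "Suc d"] that by (simp add: e_def split: if_splits)
  have "strict_mono_on {..<Suc d} s"
  proof (rule strict_mono_onI)
    fix i j assume "i \<in> {..<Suc d}" "j \<in> {..<Suc d}" "i < j"
    then show "s i < s j" using s[of i] s[of j] e_mono[of "Suc i" j] by simp
  qed
  then have fs: "real_factored f (Suc d) s"
    using s f by (intro real_factoredI) auto
  \<comment> \<open>Exactly \<open>d - i\<close> roots of \<open>p\<close> and \<open>d - i\<close>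
    roots of \<open>f\<close> lie above \<open>s i\<close>, so both factors have sign
    \<open>(-1) ^ (d - i)\<close>.\<close>
  have "poly p (s i) * poly (pderiv f) (s i) > 0" if "i \<le> d" for i
  proof -
    have "r j < s i" if "j < i" for j
      using s[OF \<open>i \<le> d\<close>] e_mono[of "Suc j" i] that \<open>i \<le> d\<close> by (simp add: e_def)
    moreover have "s i < r j" if "i \<le> j" "j < d" for j
      using s[OF \<open>i \<le> d\<close>] e_mono[of "Suc i" "Suc j"] that by (simp add: e_def)
    ultimately have "(-1) ^ (d - i) * poly p (s i) > 0"
      using \<open>i \<le> d\<close> by (intro real_factored_sign[OF p]) auto
    moreover have "(-1) ^ (d - i) * poly (pderiv f) (s i) > 0"
      using real_factored_pderiv_sign[OF fs, of i] that by simp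
    ultimately show ?thesis
      by (cases "even (d - i)") (auto simp: zero_less_mult_iff)
  qed
  with that fs ab sr show ?thesis by blast
qed

text \<open>Reflection at 0 reduces this to the behaviour at plus infinity.\<close>

lemma poly_sign_at_bot:
  fixes f :: "real poly"
  assumes "lead_coeff f > 0"
  obtains a where "a < 0" "\<And>x. x \<le> a \<Longrightarrow> (-1) ^ degree f * poly f x > 0"
proof -
  define g where "g = smult ((-1) ^ degree f) (f \<circ>\<^sub>p [:0, -1:])"
  have "lead_coeff (f \<circ>\<^sub>p [:0, -1:]) = lead_coeff f * (-1) ^ degree f"
    by (subst lead_coeff_comp) auto
  then have lc: "lead_coeff g = lead_coeff f"
    by (simp only: g_def lead_coeff_smult) (simp flip: power_mult_distrib)
  then have "lead_coeff g > 0" using assms by simp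
  then obtain N where N: "\<And>x. x \<ge> N \<Longrightarrow> poly g x \<ge> lead_coeff g"
    using poly_pinfty_gt_lc by blast
  show thesis
  proof (rule that)
    fix x assume "x \<le> - max N 1"
    then have "poly g (- x) \<ge> lead_coeff g" by (intro N) simp
    then show "(-1) ^ degree f * poly f x > 0"
      using \<open>lead_coeff g > 0\<close> by (simp add: g_def poly_pcompose)
  qed simp
qed

lemma strict_mono_on_enum_unique:
  fixes f g :: "nat \<Rightarrow> 'a :: linorder"
  assumes "strict_mono_on {..<d} f" "strict_mono_on {..<d} g" "f ` {..<d} = g ` {..<d}" "i < d"
  shows "f i = g i"
proof -
  have "sorted_wrt (<) (map h [0..<d])" if "strict_mono_on {..<d} h" for h :: "nat \<Rightarrow> 'a"
    using that by (auto simp: sorted_wrt_iff_nth_less strict_mono_on_def)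
  then have "map f [0..<d] = map g [0..<d]"
    using assms by (intro strict_sorted_equal) (auto simp: atLeast0LessThan)
  then show ?thesis using assms(4) by simp
qed

section \<open>The linear recurrence\<close>

fun keel_aux :: "real \<Rightarrow> nat \<Rightarrow> real poly" where
  "keel_aux t 0 = 1"
| "keel_aux t (Suc k) = [:1 + t, real (k + 3):] * keel_aux t k
     + [:1, 1:] * [:t, 1:] * pderiv (keel_aux t k)"

text \<open>Each step multiplies the leading coefficient by \<open>(k + 3) + k\<close>, so no
  cancellation occurs.\<close>

lemma keel_aux_degree: "degree (keel_aux t k) = k \<and> lead_coeff (keel_aux t k) > 0"
proof (induction k)
  case (Suc k)
  define R S where "R = keel_aux t k" and "S = keel_aux t (Suc k)"
  have R: "degree R = k" "coeff R k > 0" using Suc by (auto simp: R_def)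
  have S: "S = [:1 + t, real (k + 3):] * R + [:1, 1:] * [:t, 1:] * pderiv R"
    by (simp add: R_def S_def)
  \<comment> \<open>The case \<open>k = 0\<close> is separate because \<open>2 + (k - 1)\<close> is
    then 2 by truncated subtraction, which is too weak a bound.\<close>
  have "degree S \<le> Suc k"
  proof (cases "k = 0")
    case True
    then show ?thesis by (simp add: S_def)
  next
    case False
    have "degree ([:1 + t, real (k + 3):] * R) \<le> 1 + k"
      by (rule order.trans[OF degree_mult_le]) (simp add: R)
    moreover have "degree ([:1, 1:] * [:t, 1:] * pderiv R) \<le> 2 + (k - 1)"
      by (rule order.trans[OF degree_mult_le]) (simp add: R degree_pderiv degree_mult_eq)
    ultimately show ?thesis using False unfolding S by (intro degree_add_le) auto
  qed
  moreover have "coeff S (Suc k) = real (k + 3) * coeff R k + real k * coeff R k"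
    unfolding S using R by (cases k) (auto simp: coeff_pderiv coeff_eq_0 algebra_simps)
  then have "coeff S (Suc k) > 0" using R(2) by (simp add: add_pos_nonneg)
  moreover from this have "degree S \<ge> Suc k" by (intro le_degree) simp
  ultimately show ?case by (simp add: S_def del: keel_aux.simps)
qed auto

lemma poly_keel_aux_Suc:
  "poly (keel_aux t (Suc k)) x = (1 + t + real (k + 3) * x) * poly (keel_aux t k) x
     + (x + 1) * (x + t) * poly (pderiv (keel_aux t k)) x"
  by (simp add: algebra_simps)

text \<open>The factor \<open>(x + 1) * (x + t)\<close> vanishes at both ends of the interval, where
  the linear factor alone decides the sign, and is negative inside, which makes
  \<open>R_{k+1}\<close> and \<open>R_k'\<close> opposite at the roots of
  \<open>R_k\<close>.\<close>

lemma keel_aux_interlacing_step: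
  assumes "t < 0" "real_factored (keel_aux t k) k r" "\<And>i. i < k \<Longrightarrow> -1 < r i \<and> r i < - t"
  obtains s where "real_factored (keel_aux t (Suc k)) (Suc k) s"
    "\<And>i. i \<le> k \<Longrightarrow> -1 < s i \<and> s i < - t"
    "\<And>i. i \<le> k \<Longrightarrow> poly (keel_aux t k) (s i) * poly (pderiv (keel_aux t (Suc k))) (s i) > 0"
proof -
  let ?R = "keel_aux t k" and ?S = "keel_aux t (Suc k)"
  have "poly ?R (- t) > 0"
    using real_factored_sign[OF assms(2), of k "- t"] assms(3) by auto
  moreover have "1 + t - real (k + 3) * t > 0"
    using assms(1) mult_nonneg_nonpos[of "real (k + 2)" t] by (simp add: algebra_simps)
  ultimately have at_b: "poly ?S (- t) > 0"
    by (simp add: poly_keel_aux_Suc del: keel_aux.simps)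
  have "(-1) ^ k * poly ?R (-1) > 0"
    using real_factored_sign[OF assms(2), of 0 "-1"] assms(3) by auto
  moreover have "real k + 2 - t > 0" using assms(1) by simp
  ultimately have "(real k + 2 - t) * ((-1) ^ k * poly ?R (-1)) > 0" by (rule mult_pos_pos[rotated])
  then have at_a: "(-1) ^ Suc k * poly ?S (-1) > 0"
    by (simp add: poly_keel_aux_Suc algebra_simps del: keel_aux.simps)
  have opp: "poly ?S (r i) * poly (pderiv ?R) (r i) < 0" if "i < k" for i
  proof -
    have "poly ?R (r i) = 0" using real_factored_roots[OF assms(2)] that by auto
    then have "poly ?S (r i) * poly (pderiv ?R) (r i)
        = (r i + 1) * (r i + t) * (poly (pderiv ?R) (r i))\<^sup>2"
      by (simp add: poly_keel_aux_Suc power2_eq_square del: keel_aux.simps)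
    moreover have "(r i + 1) * (r i + t) < 0"
      using assms(3)[OF that] by (intro mult_pos_neg) auto
    moreover have "poly (pderiv ?R) (r i) \<noteq> 0"
      using real_factored_pderiv_sign[OF assms(2) that] by auto
    ultimately show ?thesis by (simp add: mult_neg_pos)
  qed
  show thesis
    by (rule interlacing_roots[OF assms(2), of "-1" "- t" ?S])
      (use assms keel_aux_degree[of t "Suc k"] at_a at_b opp that in
        \<open>auto simp del: keel_aux.simps\<close>)
qed

lemma keel_aux_roots:
  assumes "t < 0"
  obtains r where "real_factored (keel_aux t k) k r" "\<And>i. i < k \<Longrightarrow> -1 < r i \<and> r i < - t"
proof (induction k arbitrary: thesis)
  case 0
  show ?case by (rule 0[of "\<lambda>_. 0"]) (auto simp: real_factored_def strict_mono_on_def intro!: exI[of _ 1])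
next
  case (Suc k)
  obtain r where "real_factored (keel_aux t k) k r" "\<And>i. i < k \<Longrightarrow> -1 < r i \<and> r i < - t"
    using Suc.IH by blast
  from keel_aux_interlacing_step[OF assms this] show ?case
    by (metis Suc.prems less_Suc_eq_le)
qed

lemma keel_aux_sturm:
  assumes "t < 0" "poly (keel_aux t (Suc k)) 0 = 0"
  shows "poly (keel_aux t k) 0 * poly (keel_aux t (Suc (Suc k))) 0 < 0"
proof -
  let ?S = "keel_aux t (Suc k)"
  obtain r where r: "real_factored (keel_aux t k) k r" "\<And>i. i < k \<Longrightarrow> -1 < r i \<and> r i < - t"
    using keel_aux_roots[OF assms(1)] by blast
  obtain s where s: "real_factored ?S (Suc k) s"
      "\<And>i. i \<le> k \<Longrightarrow> poly (keel_aux t k) (s i) * poly (pderiv ?S) (s i) > 0"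
    using keel_aux_interlacing_step[OF assms(1) r] by metis
  obtain i where "i \<le> k" "s i = 0"
    using real_factored_roots[OF s(1)] assms(2)
    by (auto simp: set_eq_iff image_iff less_Suc_eq_le simp del: keel_aux.simps)
  then have "poly (keel_aux t k) 0 * poly (pderiv ?S) 0 > 0" using s(2) by metis
  \<comment> \<open>At the root 0 of \<open>R_{k+1}\<close> the recurrence keeps only its derivative
    term, whose factor there is \<open>t\<close>; this negative factor reverses the sign.\<close>
  moreover have "poly (keel_aux t (Suc (Suc k))) 0 = t * poly (pderiv ?S) 0"
    using assms(2) poly_keel_aux_Suc[of t "Suc k" 0] by simp
  ultimately show ?thesis
    using assms(1) by (simp add: mult.left_commute mult_neg_pos del: keel_aux.simps)
qed

text \<open>
  Applied with \<open>U = u\<^sup>k\<close>, \<open>Y = y\<^bsup>k+1\<^esup>\<close>, \<open>K = k\<close>, \<open>T = t\<close> and \<open>\<rho> = R\<^sub>k(c)\<close>, \<open>\<rho>' = R\<^sub>k'(c)\<close>; the first assumption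
  is the derivative of the second.\<close>
lemma linear_recurrence_step:
  fixes U :: "'a :: comm_ring_1"
  assumes "(K + 1) * U * y * E + U * u * E' = (K + 2) * Y * y' * (1 + c) * \<rho> + Y * y * c' * \<rho>
      + Y * y * (1 + c) * (\<rho>' * c')"
    and "U * u * E = Y * y * (1 + c) * \<rho>" "u * y' = y * y * (1 + c)" "c' = T * y'" "c = T * y - T"
  shows "U * u * u * E' = Y * y * y * (1 + c) * (((K + 3) * c + 1 + T) * \<rho> + (c + 1) * (c + T) * \<rho>')"
proof -
  have Ty: "T * y = c + T" using assms(5) by simp
  \<comment> \<open>The extra factor \<open>u\<close> lets \<open>E\<close> and \<open>y'\<close>
    occur only as \<open>U * u * E\<close> and \<open>u * y'\<close>, both of which the hypotheses
    eliminate.\<close>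
  have "U * u * u * E' = u * ((K + 1) * U * y * E + U * u * E') - (K + 1) * y * (U * u * E)"
    by (simp add: algebra_simps)
  also have "\<dots> = (K + 2) * Y * (u * y') * (1 + c) * \<rho> + Y * (T * y) * (u * y') * \<rho>
      + Y * (T * y) * (u * y') * (1 + c) * \<rho>' - (K + 1) * y * (Y * y * (1 + c) * \<rho>)"
    unfolding assms(1,2) assms(4) by (simp add: algebra_simps)
  also have "\<dots> = Y * y * y * (1 + c) * (((K + 3) * c + 1 + T) * \<rho> + (c + 1) * (c + T) * \<rho>')"
    unfolding assms(3) Ty by (simp add: algebra_simps)
  finally show ?thesis .
qed

section \<open>The exponential generating function of a solution of the recurrence\<close>

locale keel_manin_getzler =
  fixes P :: "nat \<Rightarrow> real poly"
  assumes P_le_3: "m \<le> 3 \<Longrightarrow> P m = 1"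
    and P_rec: "m > 3 \<Longrightarrow> P m = [:1, 1:] * P (m - 1) + [:0, 1:] *
      (\<Sum>j=3..m - 2. of_nat ((m - 2) choose (j - 1)) * P j * P (m + 1 - j))"
begin

text \<open>The constant term is set to 0, although the general formula would give
  \<open>P 1 = 1\<close> there.\<close>

definition genfun :: "real \<Rightarrow> real fps" where
  "genfun t = Abs_fps (\<lambda>n. if n = 0 then 0 else poly (P (Suc n)) t / fact n)"

text \<open>The substitutions \<open>m = n + 2\<close> and \<open>j = i + 1\<close> bring the sum
  into the form of a binomial convolution.\<close>

lemma poly_P_rec:
  assumes "n \<ge> 2"
  shows "poly (P (n + 2)) t = (1 + t) * poly (P (n + 1)) t
    + t * (\<Sum>i=2..n - 1. real (n choose i) * poly (P (i + 1)) t * poly (P (n + 2 - i)) t)"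
proof -
  obtain N where N: "n = Suc N" using assms by (cases n) auto
  have "(\<Sum>j=3..n. real (n choose (j - 1)) * poly (P j) t * poly (P (n + 3 - j)) t)
      = (\<Sum>j=Suc 2..Suc N. real (n choose (j - 1)) * poly (P j) t * poly (P (n + 3 - j)) t)"
    by (simp add: N numeral_3_eq_3)
  also have "\<dots> = (\<Sum>i=2..N. real (n choose i) * poly (P (i + 1)) t * poly (P (n + 2 - i)) t)"
    by (subst sum.shift_bounds_cl_Suc_ivl) simp
  finally have "(\<Sum>j=3..n. real (n choose (j - 1)) * poly (P j) t * poly (P (n + 3 - j)) t)
      = (\<Sum>i=2..n - 1. real (n choose i) * poly (P (i + 1)) t * poly (P (n + 2 - i)) t)"
    by (simp add: N)
  moreover have "poly (P (n + 2)) t = (1 + t) * poly (P (n + 1)) t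
      + t * (\<Sum>j=3..n. real (n choose (j - 1)) * poly (P j) t * poly (P (n + 3 - j)) t)"
    using assms by (subst P_rec) (auto simp: poly_sum numeral_3_eq_3 algebra_simps)
  ultimately show ?thesis by simp
qed

lemma genfun_nth: "genfun t $ n = (if n = 0 then 0 else poly (P (Suc n)) t / fact n)"
  by (simp add: genfun_def)

lemma genfun_deriv_nth: "fps_deriv (genfun t) $ n = poly (P (n + 2)) t / fact n"
  by (simp add: genfun_def field_simps del: of_nat_Suc)

text \<open>Comparison of coefficients: the full convolution in \<phi>\<phi>' differs from the sum
  in the recurrence by its boundary terms, which the other terms of the equation absorb.\<close>

lemma genfun_ode:
  "(1 + fps_const t * fps_X - fps_const t * genfun t) * fps_deriv (genfun t) = 1 + genfun t"
proof (rule fps_ext)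
  fix n
  let ?y = "fps_deriv (genfun t)"
  define p where "p i = poly (P i) t" for i
  have p: "p 1 = 1" "p 2 = 1" "p 3 = 1" by (simp_all add: p_def P_le_3)
  have lhs: "((1 + fps_const t * fps_X - fps_const t * genfun t) * ?y) $ n
      = ?y $ n + t * (if n = 0 then 0 else ?y $ (n - 1)) - t * (genfun t * ?y) $ n"
    by (simp add: algebra_simps)
  consider "n = 0" | "n = 1" | "n \<ge> 2" by linarith
  then show "((1 + fps_const t * fps_X - fps_const t * genfun t) * ?y) $ n = (1 + genfun t) $ n"
  proof cases
    case 3
    define q where "q i = real (n choose i) * p (i + 1) * p (n + 2 - i)" for i
    have "fact n * (genfun t * ?y) $ n = (\<Sum>i=0..n. if i = 0 then 0 else q i)"
      unfolding fps_mult_nth sum_distrib_left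
      by (intro sum.cong)
        (auto simp: genfun_nth genfun_deriv_nth q_def p_def binomial_fact Suc_diff_le simp del: fps_deriv_nth)
    also have "\<dots> = (\<Sum>i=1..n. q i)"
      by (subst sum.atLeast_Suc_atMost) (auto intro!: sum.cong)
    \<comment> \<open>As \<open>p 2 = 1\<close>, the boundary terms are \<open>n * p (n + 1)\<close>
      and \<open>p (n + 1)\<close>: the first is cancelled by the term t x \<phi>', the second
      accounts for the \<open>t\<close> in the factor \<open>1 + t\<close>.\<close>
    also have "\<dots> = q 1 + (\<Sum>i=2..n - 1. q i) + q n"
    proof -
      obtain N where N: "n = Suc N" "N \<ge> 1" using 3 by (cases n) auto
      have "(\<Sum>i=1..n. q i) = (\<Sum>i=1..N. q i) + q n" by (simp add: N)
      also have "(\<Sum>i=1..N. q i) = q 1 + (\<Sum>i=2..N. q i)"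
        using N by (subst sum.atLeast_Suc_atMost) (auto simp: numeral_2_eq_2)
      finally show ?thesis by (simp add: N)
    qed
    also have "\<dots> = (real n + 1) * p (n + 1) + (\<Sum>i=2..n - 1. q i)"
      by (simp add: q_def p numeral_2_eq_2[symmetric] algebra_simps)
    finally have conv: "fact n * (genfun t * ?y) $ n = (real n + 1) * p (n + 1) + (\<Sum>i=2..n - 1. q i)" .
    have "p (n + 2) = (1 + t) * p (n + 1) + t * (\<Sum>i=2..n - 1. q i)"
      using poly_P_rec[OF 3, of t] by (simp add: p_def q_def)
    moreover have "fact n * ?y $ n = p (n + 2)"
      unfolding genfun_deriv_nth by (simp add: p_def)
    ultimately have "fact n * ?y $ n = p (n + 1) + t * (fact n * (genfun t * ?y) $ n) - t * (real n * p (n + 1))"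
      unfolding conv by (simp add: algebra_simps del: fps_deriv_nth)
    also have "real n * p (n + 1) = fact n * ?y $ (n - 1)"
      unfolding genfun_deriv_nth using 3 by (cases n) (auto simp: p_def)
    also have "p (n + 1) = fact n * genfun t $ n"
      using 3 by (simp add: genfun_def p_def)
    finally have "fact n * (?y $ n + t * ?y $ (n - 1) - t * (genfun t * ?y) $ n) = fact n * genfun t $ n"
      by (simp add: algebra_simps)
    then have "?y $ n + t * ?y $ (n - 1) - t * (genfun t * ?y) $ n = genfun t $ n"
      by (simp only: mult_cancel_left) simp
    then show ?thesis using 3 by (subst lhs) simp
  qed (subst lhs, simp add: genfun_def fps_mult_nth P_le_3)+
qed

text \<open>The power of \<open>u\<close> clears denominators: every differentiation replaces
  \<open>y'\<close> by \<open>y * y * (1 + c) / u\<close>. Composition with \<open>c\<close> is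
  legitimate because its constant term is 0.\<close>

lemma genfun_higher_deriv:
  fixes t :: real
  defines "y \<equiv> fps_deriv (genfun t)"
  defines "c \<equiv> fps_const t * (y - 1)"
  shows "(1 + genfun t) ^ Suc k * (fps_deriv ^^ (k + 2)) (genfun t)
    = y ^ (k + 2) * (1 + c) * (fps_of_poly (keel_aux t k) oo c)"
proof -
  define u g where "u = 1 + genfun t" and "g = 1 + fps_const t * fps_X - fps_const t * genfun t"
  have c0: "c $ 0 = 0" by (simp add: c_def y_def genfun_def P_le_3)
  have u': "fps_deriv u = y" by (simp add: u_def y_def)
  have g': "fps_deriv g = fps_const t - fps_const t * y" by (simp add: g_def y_def)
  have c': "fps_deriv c = fps_const t * fps_deriv y" by (simp add: c_def)
  have c: "c = fps_const t * y - fps_const t" by (simp add: c_def algebra_simps)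
  have gy: "g * y = u" using genfun_ode[of t] by (simp add: g_def y_def u_def)
  have "fps_deriv (g * y) = y" by (simp add: gy u')
  \<comment> \<open>Product rule, with \<open>g' = - c\<close>; multiplying by \<open>y\<close> and
    using \<open>g * y = u\<close> then removes \<open>g\<close>.\<close>
  then have "g * fps_deriv y = y * (1 + c)"
    by (simp add: g' c algebra_simps)
  then have uy': "u * fps_deriv y = y * y * (1 + c)"
    unfolding gy[symmetric] by (metis mult.assoc mult.left_commute)
  have "u ^ Suc k * (fps_deriv ^^ (k + 2)) (genfun t)
    = y ^ (k + 2) * (1 + c) * (fps_of_poly (keel_aux t k) oo c)"
  proof (induction k)
    case 0
    show ?case using uy' by (simp add: y_def numeral_2_eq_2)
  next
    case (Suc k)
    define E where "E = (fps_deriv ^^ (k + 2)) (genfun t)"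
    define \<rho> \<rho>' where "\<rho> = fps_of_poly (keel_aux t k) oo c"
      and "\<rho>' = fps_of_poly (pderiv (keel_aux t k)) oo c"
    have d\<rho>: "fps_deriv \<rho> = \<rho>' * fps_deriv c"
      unfolding \<rho>_def \<rho>'_def by (simp add: fps_compose_deriv[OF c0] fps_of_poly_pderiv)
    have du: "fps_deriv (u ^ Suc k) = (of_nat k + 1) * u ^ k * y"
      by (subst fps_deriv_power') (simp add: u' algebra_simps)
    have dy: "fps_deriv (y ^ Suc (Suc k)) = (of_nat k + 2) * y ^ (k + 1) * fps_deriv y"
      by (subst fps_deriv_power') (simp add: algebra_simps)
    have "u ^ Suc k * E = y ^ Suc (Suc k) * (1 + c) * \<rho>"
      using Suc.IH by (simp add: E_def \<rho>_def algebra_simps)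
    from arg_cong[OF this, of fps_deriv]
    have "(of_nat k + 1) * u ^ k * y * E + u ^ k * u * fps_deriv E
        = (of_nat k + 2) * y ^ (k + 1) * fps_deriv y * (1 + c) * \<rho> + y ^ (k + 1) * y * fps_deriv c * \<rho>
          + y ^ (k + 1) * y * (1 + c) * (\<rho>' * fps_deriv c)"
      by (simp only: fps_deriv_mult du dy d\<rho>) (simp add: algebra_simps)
    moreover have "u ^ k * u * E = y ^ (k + 1) * y * (1 + c) * \<rho>"
      using Suc.IH by (simp add: E_def \<rho>_def algebra_simps)
    ultimately
    have "u ^ k * u * u * fps_deriv E = y ^ (k + 1) * y * y * (1 + c)
       * (((of_nat k + 3) * c + 1 + fps_const t) * \<rho> + (c + 1) * (c + fps_const t) * \<rho>')"
      using uy' c' c by (rule linear_recurrence_step)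
    also have "((of_nat k + 3) * c + 1 + fps_const t) * \<rho> + (c + 1) * (c + fps_const t) * \<rho>'
        = fps_of_poly (keel_aux t (Suc k)) oo c"
    proof -
      have const_eqs: "fps_const (1 + t) = 1 + fps_const t" "fps_const (real k + 3) = of_nat k + 3"
        by (simp_all add: fps_of_nat numeral_fps_const flip: fps_const_add)
      show ?thesis
        by (simp add: const_eqs \<rho>_def \<rho>'_def fps_of_poly_simps fps_of_poly_pCons fps_compose_add_distrib
          fps_compose_mult_distrib[OF c0] fps_X_fps_compose_startby0[OF c0] algebra_simps)
    qed
    finally show ?case
      by (simp add: E_def algebra_simps del: keel_aux.simps)
  qed
  then show ?thesis by (simp add: u_def)
qed

text \<open>At x = 0 one has \<open>u = y = 1\<close> and \<open>c = 0\<close>, so the derivative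
  formula reduces to this.\<close>

lemma poly_P_eq_keel_aux: "poly (P (k + 3)) t = poly (keel_aux t k) 0"
proof -
  have "((1 + genfun t) ^ Suc k * (fps_deriv ^^ (k + 2)) (genfun t)) $ 0 = poly (P (k + 3)) t"
    by (simp add: fps_0th_higher_deriv fps_power_zeroth genfun_nth numeral_3_eq_3
        del: funpow.simps)
  then show ?thesis
    unfolding genfun_higher_deriv
    by (simp add: fps_power_zeroth genfun_def P_le_3 poly_0_coeff_0)
qed

section \<open>Interlacing of the Poincare polynomials\<close>

lemma P_sturm:
  assumes "t < 0" "poly (P (k + 4)) t = 0"
  shows "poly (P (k + 3)) t * poly (P (k + 5)) t < 0"
  using keel_aux_sturm[of t k] poly_P_eq_keel_aux[of k t] poly_P_eq_keel_aux[of "Suc k" t]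
    poly_P_eq_keel_aux[of "Suc (Suc k)" t] assms
  by (simp add: numeral_eq_Suc del: keel_aux.simps)

text \<open>The products in the sum have degree at most
  \<open>(j - 3) + (m - j - 2) = m - 5\<close>, so only the term with \<open>1 + t\<close> reaches
  degree \<open>m - 3\<close>.\<close>

lemma P_monic: "degree (P (k + 3)) = k \<and> coeff (P (k + 3)) k = 1"
proof (induction k rule: less_induct)
  case (less k)
  show ?case
  proof (cases k)
    case 0
    then show ?thesis by (simp add: P_le_3)
  next
    case (Suc l)
    let ?m = "k + 3"
    define S where "S = (\<Sum>j=3..?m - 2. of_nat ((?m - 2) choose (j - 1)) * P j * P (?m + 1 - j))"
    have rec: "P ?m = [:1, 1:] * P (l + 3) + [:0, 1:] * S"
    proof -
      have "?m - 1 = l + 3" using Suc by simp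
      with P_rec[of ?m] Suc show ?thesis unfolding S_def by (metis less_add_same_cancel2 zero_less_Suc)
    qed
    have l: "degree (P (l + 3)) = l" "coeff (P (l + 3)) l = 1"
      using less[of l] Suc by auto
    have deg_P: "degree (P j) \<le> j - 3" if "j < ?m" for j
    proof (cases "j \<le> 3")
      case False
      then show ?thesis using less[of "j - 3"] that by simp
    qed (simp add: P_le_3)
    have "degree S \<le> k - 2"
      unfolding S_def
    proof (intro degree_sum_le)
      fix j assume j: "j \<in> {3..?m - 2}"
      have "degree (of_nat ((?m - 2) choose (j - 1)) * P j * P (?m + 1 - j))
          \<le> degree (P j) + degree (P (?m + 1 - j))"
        by (rule order.trans[OF degree_mult_le] order.trans[OF add_right_mono[OF degree_mult_le]])+ simp
      also have "\<dots> \<le> (j - 3) + (?m + 1 - j - 3)"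
        using j by (intro add_mono deg_P) auto
      also have "\<dots> \<le> k - 2" using j by auto
      finally show "degree (of_nat ((?m - 2) choose (j - 1)) * P j * P (?m + 1 - j)) \<le> k - 2" .
    qed simp
    \<comment> \<open>For \<open>k = 1\<close> the bound \<open>k - 2\<close> truncates to 0 and
      would not suffice, but the sum is empty.\<close>
    moreover have "S = 0" if "k = 1" using that by (simp add: S_def)
    ultimately have S: "degree ([:0, 1:] * S) < k"
      using Suc by (cases "S = 0"; cases "k = 1") (auto simp: degree_mult_eq)
    have "P (l + 3) \<noteq> 0" using l by auto
    then have "degree ([:1, 1:] * P (l + 3)) = k"
      using l Suc by (subst degree_mult_eq) auto
    moreover have "coeff ([:1, 1:] * P (l + 3)) k = 1"
      using l Suc by (simp add: coeff_eq_0)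
    ultimately show ?thesis
      unfolding rec using S by (auto simp: degree_add_eq_left coeff_eq_0 simp del: mult_pCons_left)
  qed
qed

lemma P_at_0: "poly (P m) 0 = 1"
proof (induction m)
  case (Suc m)
  then show ?case by (cases "Suc m \<le> 3") (simp_all add: P_le_3 P_rec del: One_nat_def)
qed (simp add: P_le_3)

lemma P_interlacing_step:
  assumes "real_factored (P (k + 3)) k r" "\<And>i. i < k \<Longrightarrow> r i < 0"
    and "\<And>i. i < k \<Longrightarrow> poly (P (k + 4)) (r i) * poly (pderiv (P (k + 3))) (r i) < 0"
  obtains s where "real_factored (P (k + 4)) (Suc k) s" "\<And>i. i \<le> k \<Longrightarrow> s i < 0"
    "\<And>i. i < k \<Longrightarrow> s i < r i \<and> r i < s (Suc i)"
    "\<And>i. i \<le> k \<Longrightarrow> poly (P (k + 3)) (s i) * poly (pderiv (P (k + 4))) (s i) > 0"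
proof -
  have f: "degree (P (k + 4)) = Suc k" "lead_coeff (P (k + 4)) > 0"
    using P_monic[of "Suc k"] by (simp_all add: numeral_eq_Suc)
  obtain b where b: "b < 0" "\<And>x. x \<le> b \<Longrightarrow> (-1) ^ Suc k * poly (P (k + 4)) x > 0"
    using poly_sign_at_bot[OF f(2)] f(1) by metis
  \<comment> \<open>A left end below all roots of \<open>P (k + 3)\<close> and in the range where
    the leading term fixes the sign of \<open>P (k + 4)\<close>; the right end is 0, where the value
    is 1.\<close>
  define a where "a = Min (insert b (r ` {..<k})) - 1"
  have a: "a < b" "\<And>i. i < k \<Longrightarrow> a < r i"
  proof -
    have "a < x" if "x \<in> insert b (r ` {..<k})" for x
      using Min_le[OF _ that] by (simp add: a_def)
    then show "a < b" "\<And>i. i < k \<Longrightarrow> a < r i" by blast+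
  qed
  show thesis
    by (rule interlacing_roots[OF assms(1), of a 0 "P (k + 4)"])
      (use a b f assms P_at_0[of "k + 4"] that in auto)
qed

text \<open>The opposite signs are carried through the induction: at a root of \<open>P_m\<close>,
  interlacing gives \<open>P_{m-1}\<close> the sign of \<open>P_m'\<close>, and the Sturm property
  gives \<open>P_{m+1}\<close> the opposite one.\<close>

lemma P_roots:
  obtains r where "real_factored (P (k + 3)) k r" "\<And>i. i < k \<Longrightarrow> r i < 0"
    "\<And>i. i < k \<Longrightarrow> poly (P (k + 4)) (r i) * poly (pderiv (P (k + 3))) (r i) < 0"
proof (induction k arbitrary: thesis)
  case 0
  show ?case
    by (rule 0[of "\<lambda>_. 0"]) (auto simp: real_factored_def strict_mono_on_def P_le_3 intro!: exI[of _ 1])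
next
  case (Suc k)
  obtain r where r: "real_factored (P (k + 3)) k r" "\<And>i. i < k \<Longrightarrow> r i < 0"
    "\<And>i. i < k \<Longrightarrow> poly (P (k + 4)) (r i) * poly (pderiv (P (k + 3))) (r i) < 0"
    using Suc.IH by blast
  obtain s where s: "real_factored (P (k + 4)) (Suc k) s" "\<And>i. i \<le> k \<Longrightarrow> s i < 0"
    "\<And>i. i \<le> k \<Longrightarrow> poly (P (k + 3)) (s i) * poly (pderiv (P (k + 4))) (s i) > 0"
    using P_interlacing_step[OF r] by metis
  have k: "Suc k + 3 = k + 4" "Suc k + 4 = k + 5" by simp_all
  have "poly (P (k + 5)) (s i) * poly (pderiv (P (k + 4))) (s i) < 0" if "i \<le> k" for i
  proof -
    have "poly (P (k + 4)) (s i) = 0" using real_factored_roots[OF s(1)] that by auto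
    with P_sturm s(2)[OF that] have "poly (P (k + 3)) (s i) * poly (P (k + 5)) (s i) < 0" by blast
    with s(3)[OF that] show ?thesis by (auto simp: zero_less_mult_iff mult_less_0_iff)
  qed
  then show ?case
    using s(1,2) by (intro Suc.prems[of s]) (simp_all only: k less_Suc_eq_le)
qed

end

section \<open>Transfer to the given lists of roots\<close>

theorem theorem1p2:
  fixes n :: nat and \<tau> \<sigma> :: "nat \<Rightarrow> real"
  assumes Keel_Manin_Getzler:
      "\<forall>m>3. poincare_poly m = [:1, 1:] * poincare_poly (m - 1)
         + [:0, 1:] *
           (\<Sum>j=3..m - 2. of_nat ((m - 2) choose (j - 1)) * poincare_poly j
             * poincare_poly (m + 1 - j))"
    and "n \<ge> 4"
    and "strict_mono_on {1..n - 3} \<tau>" and "\<tau> (n - 3) < 0"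
    and "\<tau> ` {1..n - 3} = {t. poly (poincare_poly n) t = 0}"
    and "strict_mono_on {1..n - 2} \<sigma>" and "\<sigma> (n - 2) < 0"
    and "\<sigma> ` {1..n - 2} = {t. poly (poincare_poly (n + 1)) t = 0}"
  shows "(\<forall>i\<in>{1..n - 3}. \<sigma> i < \<tau> i \<and> \<tau> i < \<sigma> (i + 1)) \<and> \<sigma> (n - 2) < 0"
proof -
  \<comment> \<open>Cohomology enters only through the recurrence; the initial values are the
    convention for \<open>n \<le> 3\<close>.\<close>
  interpret keel_manin_getzler poincare_poly
    using Keel_Manin_Getzler by unfold_locales (simp_all add: poincare_poly_def)
  define k where "k = n - 3"
  have n: "n = k + 3" "n + 1 = k + 4" "n - 2 = Suc k" using \<open>n \<ge> 4\<close> by (simp_all add: k_def)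
  obtain r where r: "real_factored (poincare_poly (k + 3)) k r" "\<And>i. i < k \<Longrightarrow> r i < 0"
    "\<And>i. i < k \<Longrightarrow> poly (poincare_poly (k + 4)) (r i) * poly (pderiv (poincare_poly (k + 3))) (r i) < 0"
    using P_roots by blast
  obtain s where s: "real_factored (poincare_poly (k + 4)) (Suc k) s"
    "\<And>i. i < k \<Longrightarrow> s i < r i \<and> r i < s (Suc i)"
    using P_interlacing_step[OF r] by metis
  \<comment> \<open>The given lists start at index 1, the constructed ones at 0. After the shift
    both enumerate the same set increasingly and so agree.\<close>
  have shift: "strict_mono_on {..<d} (\<lambda>i. f (Suc i)) \<and> (\<lambda>i. f (Suc i)) ` {..<d} = f ` {1..d}"
    if "strict_mono_on {1..d} f" for d and f :: "nat \<Rightarrow> real"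
  proof
    show "strict_mono_on {..<d} (\<lambda>i. f (Suc i))"
      using that by (auto simp: strict_mono_on_def)
    show "(\<lambda>i. f (Suc i)) ` {..<d} = f ` {1..d}"
      using image_Suc_lessThan[of d] by (metis image_image)
  qed
  have mono: "strict_mono_on {..<k} r" "strict_mono_on {..<Suc k} s"
    using r(1) s(1) unfolding real_factored_def by blast+
  have "\<tau> ` {1..k} = r ` {..<k}" "\<sigma> ` {1..Suc k} = s ` {..<Suc k}"
    using assms(5,8) real_factored_roots[OF r(1)] real_factored_roots[OF s(1)]
    by (simp_all only: n(2,3) flip: k_def n(1))
  moreover have "strict_mono_on {1..k} \<tau>" "strict_mono_on {1..Suc k} \<sigma>"
    using assms(3,6) by (simp_all only: n(3) flip: k_def)
  ultimately have \<tau>: "\<forall>i<k. \<tau> (Suc i) = r i" and \<sigma>: "\<forall>i<Suc k. \<sigma> (Suc i) = s i"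
    using strict_mono_on_enum_unique[OF _ mono(1)] strict_mono_on_enum_unique[OF _ mono(2)] shift
    by metis+
  have "\<sigma> i < \<tau> i \<and> \<tau> i < \<sigma> (i + 1)" if i: "i \<in> {1..k}" for i
  proof -
    obtain j where "i = Suc j" "j < k" using i by (cases i) auto
    with s(2)[of j] \<tau> \<sigma> show ?thesis by simp
  qed
  then show ?thesis using assms(7) by (simp add: k_def)
qed

end
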